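(* No non-simple, semisimple Lie algebra (finite-dimensional, over $\mathbb{C}$) is regular extreme. That is, if $\mathfrak{g}=\bigoplus_{i=1}^k\mathfrak{g}^i$ with each $\mathfrak{g}^i$ a simple Lie algebra and $k>1$, then $\mathfrak{g}$ has a regular subalgebra that is neither narrow nor wide.
   Context: All Lie algebras and modules are over $\mathbb{C}$ and finite-dimensional. Semisimple Lie algebras are nonzero, and are the direct sums of simple Lie algebras; a non-simple semisimple Lie algebra is thus a direct sum of $k>1$ simple Lie algebras. Let $\mathfrak{g}$ be a semisimple Lie algebra. A subalgebra $\mathfrak{s}\subseteq\mathfrak{g}$ is wide if every simple $\mathfrak{g}$-module remains indecomposable when restricted to $\mathfrak{s}$. A subalgebra $\mathfrak{s}\subseteq\mathfrak{g}$ is narrow if for every non-trivial simple $\mathfrak{g}$-module $V$ (i.e. $V=V(\lambda)$ with highest weight $\lambda\neq 0$), the restriction of $V$ to $\mathfrak{s}$ has a proper decomposition, i.e. is a direct sum of two nonzero $\mathfrak{s}$-submodules. A subalgebra of $\mathfrak{g}$ is regular if it is normalized by some Cartan subalgebra of $\mathfrak{g}$. Fix a Cartan subalgebra $\mathfrak{h}$ with root system $\Phi$ and root spaces $\mathfrak{g}_\alpha$, $\alpha\in\Phi$. A subset $T\subseteq\Phi$ is closed if $x,y\in T$ and $x+y\in\Phi$ imply $x+y\in T$. The regular subalgebras normalized by $\mathfrak{h}$ are exactly the subalgebras $\mathfrak{s}_{T,\mathfrak{t}}=\mathfrak{t}\oplus\bigoplus_{\alpha\in T}\mathfrak{g}_\alpha$,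 where $T\subseteq\Phi$ is closed (possibly empty) and $\mathfrak{t}$ is a subspace of $\mathfrak{h}$ containing $[\mathfrak{g}_\alpha,\mathfrak{g}_{-\alpha}]$ for every $\alpha\in T$ with $-\alpha\in T$. Every regular subalgebra is conjugate, under the adjoint group of $\mathfrak{g}$, to one of this form. A semisimple Lie algebra $\mathfrak{g}$ is regular extreme if every regular subalgebra of $\mathfrak{g}$ is either narrow or wide. *)

theory Defs
  imports Complex_Main "HOL-Library.Function_Algebras" "HOL-Library.FuncSet"
begin

section \<open>Finite-dimensional complex Lie algebras\<close>

locale fd_complex_lie_algebra = vector_space scale
  for scale :: "complex \<Rightarrow> 'g::ab_group_add \<Rightarrow> 'g" +
  fixes bracket :: "'g \<Rightarrow> 'g \<Rightarrow> 'g"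
  assumes finite_dim: "\<exists>B. finite B \<and> span B = UNIV"
    and bracket_add_left: "bracket (x + y) z = bracket x z + bracket y z"
    and bracket_add_right: "bracket x (y + z) = bracket x y + bracket x z"
    and bracket_scale_left: "bracket (scale c x) y = scale c (bracket x y)"
    and bracket_scale_right: "bracket x (scale c y) = scale c (bracket x y)"
    and bracket_self: "bracket x x = 0"
    and jacobi: "bracket x (bracket y z) + bracket y (bracket z x) + bracket z (bracket x y) = 0"
begin

definition subalgebra :: "'g set \<Rightarrow> bool" where
  "subalgebra S \<longleftrightarrow> subspace S \<and> (\<forall>x\<in>S. \<forall>y\<in>S. bracket x y \<in> S)"

definition ideal_of :: "'g set \<Rightarrow> 'g set \<Rightarrow> bool" where
  "ideal_of I S \<longleftrightarrow> subspace I \<and> I \<subseteq> S \<and> (\<forall>x\<in>S. \<forall>y\<in>I. bracket x y \<in> I)"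

text \<open>A subalgebra \<open>S\<close> that is a simple Lie algebra in its own right: non-abelian, and
  without proper nonzero ideals. The ambient algebra is simple iff \<^term>\<open>UNIV\<close> is.\<close>

definition simple :: "'g set \<Rightarrow> bool" where
  "simple S \<longleftrightarrow> subalgebra S \<and> (\<exists>x\<in>S. \<exists>y\<in>S. bracket x y \<noteq> 0) \<and>
     (\<forall>I. ideal_of I S \<longrightarrow> I = {0} \<or> I = S)"

text \<open>The ambient algebra is the internal direct sum, as a Lie algebra, of
  \<open>L 1, \<dots>, L k\<close>. The values of \<open>L\<close> outside \<open>{1..k}\<close> are irrelevant.\<close>

definition direct_sum :: "nat \<Rightarrow> (nat \<Rightarrow> 'g set) \<Rightarrow> bool" where
  "direct_sum k L \<longleftrightarrow>
     (\<forall>i\<in>{1..k}. subalgebra (L i)) \<and>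
     (\<forall>i\<in>{1..k}. \<forall>j\<in>{1..k}. i \<noteq> j \<longrightarrow> (\<forall>x\<in>L i. \<forall>y\<in>L j. bracket x y = 0)) \<and>
     (\<forall>x. \<exists>!f. f \<in> (\<Pi>\<^sub>E i\<in>{1..k}. L i) \<and> x = (\<Sum>i\<in>{1..k}. f i))"

definition semisimple :: bool where
  "semisimple \<longleftrightarrow> (\<exists>k L. k \<ge> 1 \<and> direct_sum k L \<and> (\<forall>i\<in>{1..k}. simple (L i)))"


section \<open>Cartan subalgebras and regular subalgebras\<close>

fun lower_central :: "'g set \<Rightarrow> nat \<Rightarrow> 'g set" where
  "lower_central S 0 = S"
| "lower_central S (Suc n) = span {bracket x y | x y. x \<in> S \<and> y \<in> lower_central S n}"

definition nilpotent :: "'g set \<Rightarrow> bool" where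
  "nilpotent S \<longleftrightarrow> (\<exists>n. lower_central S n = {0})"

definition normalizer :: "'g set \<Rightarrow> 'g set" where
  "normalizer S = {x. \<forall>y\<in>S. bracket x y \<in> S}"

definition cartan_subalgebra :: "'g set \<Rightarrow> bool" where
  "cartan_subalgebra H \<longleftrightarrow> subalgebra H \<and> nilpotent H \<and> normalizer H = H"

definition regular_subalgebra :: "'g set \<Rightarrow> bool" where
  "regular_subalgebra S \<longleftrightarrow> subalgebra S \<and> (\<exists>H. cartan_subalgebra H \<and> H \<subseteq> normalizer S)"

end


section \<open>Finite-dimensional modules\<close>

text \<open>One cannot quantify over types inside a definition, so the underlying vector spaces of
  modules range over the finite-dimensional subspaces of \<open>nat \<Rightarrow> complex\<close>. Every
  finite-dimensional complex vector space is isomorphic to one of these (e.g. to the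
  space of functions vanishing outside \<open>{..<n}\<close>), hence every finite-dimensional module is
  isomorphic to one considered here.\<close>

type_synonym cseq = "nat \<Rightarrow> complex"

definition cseq_scale :: "complex \<Rightarrow> cseq \<Rightarrow> cseq" where
  "cseq_scale c v = (\<lambda>i. c * v i)"

interpretation cseq: vector_space cseq_scale
  by unfold_locales (auto simp: cseq_scale_def fun_eq_iff algebra_simps)

context fd_complex_lie_algebra
begin

text \<open>Only the values \<open>act x v\<close> with \<open>v \<in> V\<close> matter.\<close>

definition lie_module :: "cseq set \<Rightarrow> ('g \<Rightarrow> cseq \<Rightarrow> cseq) \<Rightarrow> bool" where
  "lie_module V act \<longleftrightarrow>
     (\<exists>B. finite B \<and> cseq.span B = V) \<and>
     (\<forall>x. \<forall>v\<in>V. act x v \<in> V) \<and>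
     (\<forall>x. \<forall>v\<in>V. \<forall>w\<in>V. act x (v + w) = act x v + act x w) \<and>
     (\<forall>x c. \<forall>v\<in>V. act x (cseq_scale c v) = cseq_scale c (act x v)) \<and>
     (\<forall>x y. \<forall>v\<in>V. act (x + y) v = act x v + act y v) \<and>
     (\<forall>x c. \<forall>v\<in>V. act (scale c x) v = cseq_scale c (act x v)) \<and>
     (\<forall>x y. \<forall>v\<in>V. act (bracket x y) v = act x (act y v) - act y (act x v))"

text \<open>\<open>W\<close> is a submodule of the restriction of the module \<open>V\<close> to \<open>S\<close>.\<close>

definition submodule :: "'g set \<Rightarrow> cseq set \<Rightarrow> ('g \<Rightarrow> cseq \<Rightarrow> cseq) \<Rightarrow> cseq set \<Rightarrow> bool" where
  "submodule S V act W \<longleftrightarrow> cseq.subspace W \<and> W \<subseteq> V \<and> (\<forall>x\<in>S. \<forall>w\<in>W. act x w \<in> W)"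

definition simple_module :: "cseq set \<Rightarrow> ('g \<Rightarrow> cseq \<Rightarrow> cseq) \<Rightarrow> bool" where
  "simple_module V act \<longleftrightarrow> lie_module V act \<and> V \<noteq> {0} \<and>
     (\<forall>W. submodule UNIV V act W \<longrightarrow> W = {0} \<or> W = V)"

definition trivial_module :: "cseq set \<Rightarrow> ('g \<Rightarrow> cseq \<Rightarrow> cseq) \<Rightarrow> bool" where
  "trivial_module V act \<longleftrightarrow> (\<forall>x. \<forall>v\<in>V. act x v = 0)"

definition decomposable :: "'g set \<Rightarrow> cseq set \<Rightarrow> ('g \<Rightarrow> cseq \<Rightarrow> cseq) \<Rightarrow> bool" where
  "decomposable S V act \<longleftrightarrow>
     (\<exists>W1 W2. submodule S V act W1 \<and> submodule S V act W2 \<and> W1 \<noteq> {0} \<and> W2 \<noteq> {0} \<and>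
        W1 \<inter> W2 = {0} \<and> V = {w1 + w2 | w1 w2. w1 \<in> W1 \<and> w2 \<in> W2})"

definition indecomposable :: "'g set \<Rightarrow> cseq set \<Rightarrow> ('g \<Rightarrow> cseq \<Rightarrow> cseq) \<Rightarrow> bool" where
  "indecomposable S V act \<longleftrightarrow> V \<noteq> {0} \<and> \<not> decomposable S V act"


section \<open>Wide, narrow, regular extreme\<close>

definition wide :: "'g set \<Rightarrow> bool" where
  "wide S \<longleftrightarrow> subalgebra S \<and> (\<forall>V act. simple_module V act \<longrightarrow> indecomposable S V act)"

text \<open>For a simple module, having highest weight \<open>0\<close> means that the algebra acts by zero.\<close>

definition narrow :: "'g set \<Rightarrow> bool" where
  "narrow S \<longleftrightarrow> subalgebra S \<and>
     (\<forall>V act. simple_module V act \<and> \<not> trivial_module V act \<longrightarrow> decomposable S V act)"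

definition regular_extreme :: bool where
  "regular_extreme \<longleftrightarrow> (\<forall>S. regular_subalgebra S \<longrightarrow> narrow S \<or> wide S)"

end

end

theory Submission
  imports Defs
begin

text \<open>Take the first simple summand \<open>L 1\<close>. Its adjoint module is simple over the whole algebra and
  over \<open>L 1\<close>, so \<open>L 1\<close> is not narrow. It acts by zero on the adjoint module \<open>L 2\<close>, which has
  dimension at least 2, so \<open>L 1\<close> is not wide. As an ideal it is normalized by every Cartan
  subalgebra, so it remains to see that one exists: the generalized null space of \<open>ad x\<close> of
  minimal dimension is self-normalizing, and it is nilpotent by Engel's theorem.\<close>

section \<open>Linear algebra: complements, stabilising chains and operator pencils\<close>

text \<open>Extend \<open>v\<close> to a basis of \<open>V\<close>: the line through
  \<open>v\<close> and the span of the other basis vectors are complementary, and \<open>w\<close>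
  off that line makes the second one nonzero. This serves modules with zero action, where every
  subspace is a submodule.\<close>

lemma (in vector_space) subspace_proper_decomposition:
  assumes V: "subspace V" and v: "v \<in> V" "v \<noteq> 0" and w: "w \<in> V" "w \<notin> span {v}"
  shows "\<exists>W1 W2. subspace W1 \<and> subspace W2 \<and> W1 \<noteq> {0} \<and> W2 \<noteq> {0} \<and> W1 \<inter> W2 = {0} \<and>
    V = {w1 + w2 | w1 w2. w1 \<in> W1 \<and> w2 \<in> W2}"
proof -
  obtain B where B: "{v} \<subseteq> B" "B \<subseteq> V" "independent B" "V \<subseteq> span B"
    using maximal_independent_subset_extend[of "{v}" V] v by auto
  define W1 W2 where "W1 = span {v}" and "W2 = span (B - {v})"
  have "span ({v} \<union> (B - {v})) = V"
    using B V by (metis Un_Diff_cancel Un_absorb1 span_subspace)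
  then have sum: "V = {w1 + w2 | w1 w2. w1 \<in> W1 \<and> w2 \<in> W2}"
    by (simp only: span_Un W1_def W2_def)
  have "v \<notin> W2"
    using B(1,3) unfolding W2_def dependent_def by blast
  have "x = 0" if x: "x \<in> W1" "x \<in> W2" for x
  proof -
    obtain c where c: "x = scale c v"
      using x(1) by (auto simp: W1_def span_singleton)
    have "c = 0"
    proof (rule ccontr)
      assume "c \<noteq> 0"
      then have "v = scale (inverse c) x"
        by (simp add: c)
      then show False
        using \<open>v \<notin> W2\<close> x(2) unfolding W2_def by (metis span_scale)
    qed
    then show ?thesis by (simp add: c)
  qed
  then have "W1 \<inter> W2 = {0}"
    by (auto simp: W1_def W2_def span_zero)
  moreover have "W1 \<noteq> {0}"
    using v(2) span_base[of v "{v}"] by (auto simp: W1_def)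
  moreover have "W2 \<noteq> {0}"
    using w sum by (auto simp: W1_def)
  moreover have "subspace W1" "subspace W2"
    by (simp_all add: W1_def W2_def)
  ultimately show ?thesis
    using sum by (intro exI[of _ W1] exI[of _ W2] conjI)
qed

context finite_dimensional_vector_space
begin

text \<open>Each strict step raises the dimension by at least one, so two neighbours agree at some
  index at most \<open>dimension\<close>; \<open>stable\<close> then propagates the equality. It is
  applied to kernels of powers and to the upper central series.\<close>

lemma subspace_chain_stabilises:
  fixes W :: "nat \<Rightarrow> 'b set"
  assumes sub: "\<And>i. subspace (W i)"
    and mono: "\<And>i. W i \<subseteq> W (Suc i)"
    and stable: "\<And>i. W i = W (Suc i) \<Longrightarrow> W (Suc i) = W (Suc (Suc i))"
  shows "W n \<subseteq> W dimension"
proof -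
  have stays: "W (i + k) = W i" if "W i = W (Suc i)" for i k
  proof -
    have "W (i + k) = W (Suc (i + k))"
      by (induction k) (use that stable in auto)
    then have "W (i + k) = W (Suc (i + k))" for k
      by (induction k) (use that stable in auto)
    then show ?thesis
      by (induction k) auto
  qed
  have "\<exists>i\<le>dimension. W i = W (Suc i)"
  proof (rule ccontr)
    assume "\<not> ?thesis"
    then have ne: "W i \<noteq> W (Suc i)" if "i \<le> dimension" for i
      using that by blast
    have "i \<le> Suc dimension \<Longrightarrow> i \<le> dim (W i)" for i
    proof (induction i)
      case (Suc i)
      have "span (W i) \<subset> span (W (Suc i))"
        using ne[of i] mono[of i] Suc.prems by (simp add: span_eq_iff[THEN iffD2, OF sub] psubset_eq)
      then show ?case
        using dim_psubset[of "W i" "W (Suc i)"] Suc by simp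
    qed simp
    from this[of "Suc dimension"] dim_subset_UNIV[of "W (Suc dimension)"]
    show False by simp
  qed
  then obtain i where i: "i \<le> dimension" "W i = W (Suc i)"
    by blast
  have "W dimension = W i"
    using stays[OF i(2), of "dimension - i"] i(1) by simp
  moreover have "W n \<subseteq> W i"
  proof (cases "n \<le> i")
    case True
    then show ?thesis
      by (rule lift_Suc_mono_le[of W, rotated]) (rule mono)
  next
    case False
    then show ?thesis
      using stays[OF i(2), of "n - i"] by simp
  qed
  ultimately show ?thesis by simp
qed

lemma linear_funpow:
  assumes "Vector_Spaces.linear scale scale f"
  shows "Vector_Spaces.linear scale scale (f ^^ n)"
proof (induction n)
  case 0
  show ?case
    by (simp add: id_def[symmetric] linear_id)
next
  case (Suc n)
  then show ?case
    unfolding funpow.simps by (rule Vector_Spaces.linear_compose[OF _ assms])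
qed

lemma funpow_eq_0_imp_funpow_dimension_eq_0:
  assumes f: "Vector_Spaces.linear scale scale f" and "(f ^^ n) v = 0"
  shows "(f ^^ dimension) v = 0"
proof -
  interpret f: Vector_Spaces.linear scale scale f by (rule f)
  interpret pow: Vector_Spaces.linear scale scale "f ^^ k" for k
    by (rule linear_funpow[OF f])
  have "{v. (f ^^ n) v = 0} \<subseteq> {v. (f ^^ dimension) v = 0}"
  proof (rule subspace_chain_stabilises)
    fix i
    show "subspace {v. (f ^^ i) v = 0}"
      by (auto simp: subspace_def pow.add pow.scale pow.zero)
    show "{v. (f ^^ i) v = 0} \<subseteq> {v. (f ^^ Suc i) v = 0}"
      by (auto simp: f.zero)
    assume eq: "{v. (f ^^ i) v = 0} = {v. (f ^^ Suc i) v = 0}"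
    have "(f ^^ Suc i) v = 0 \<longleftrightarrow> (f ^^ Suc (Suc i)) v = 0" for v
      using eq unfolding funpow_Suc_right set_eq_iff by simp
    then show "{v. (f ^^ Suc i) v = 0} = {v. (f ^^ Suc (Suc i)) v = 0}"
      by blast
  qed
  with assms(2) show ?thesis
    by blast
qed

text \<open>For a singular \<open>c\<close> the witness satisfies \<open>f v = - c g v\<close>
  modulo \<open>H\<close>. Such witnesses behave like eigenvectors for distinct eigenvalues: they
  are independent modulo \<open>H\<close>, so there are at most \<open>dimension\<close> of
  them.\<close>

lemma finite_singular_pencil:
  assumes f: "Vector_Spaces.linear scale scale f" and g: "Vector_Spaces.linear scale scale g"
    and H: "subspace H" and gH: "g ` H \<subseteq> H" and inj: "\<And>v. f v \<in> H \<Longrightarrow> v \<in> H"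
  shows "finite {c. \<exists>v. v \<notin> H \<and> f v + scale c (g v) \<in> H}"
proof -
  interpret f: Vector_Spaces.linear scale scale f by (rule f)
  interpret g: Vector_Spaces.linear scale scale g by (rule g)
  define B where "B = {c. \<exists>v. v \<notin> H \<and> f v + scale c (g v) \<in> H}"
  have "\<forall>c\<in>B. \<exists>v. v \<notin> H \<and> f v + scale c (g v) \<in> H"
    by (simp add: B_def)
  then have "\<exists>v. \<forall>c\<in>B. v c \<notin> H \<and> f (v c) + scale c (g (v c)) \<in> H"
    by (rule bchoice)
  then obtain v where v: "\<And>c. c \<in> B \<Longrightarrow> v c \<notin> H"
    and fg: "\<And>c. c \<in> B \<Longrightarrow> f (v c) + scale c (g (v c)) \<in> H"
    by (elim exE) blast
  \<comment> \<open>At \<open>c = 0\<close> the witness would contradict \<open>inj\<close>; this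
    allows division by \<open>c\<close> below.\<close>
  have nz: "c \<noteq> 0" if "c \<in> B" for c
    using that inj by (auto simp: B_def)
  have indep: "\<forall>c\<in>G. a c = 0"
    if "finite G" "G \<subseteq> B" "(\<Sum>c\<in>G. scale (a c) (v c)) \<in> H" for G a
    using that
  proof (induction G arbitrary: a rule: finite_induct)
    case (insert d G)
    \<comment> \<open>Dividing the coefficients by \<open>c\<close> makes \<open>f ?t + g ?s\<close>
      a combination of the vectors \<open>f (v c) + c g (v c)\<close> of \<open>H\<close>, so
      \<open>f ?t\<close>, and by \<open>inj\<close> also \<open>?t\<close>, lies in
      \<open>H\<close>. The combination \<open>?s - d ?t\<close> loses its \<open>v d\<close> term,
      and the induction hypothesis applies to it.\<close>
    let ?s = "\<Sum>c\<in>insert d G. scale (a c) (v c)"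
    let ?t = "\<Sum>c\<in>insert d G. scale (a c / c) (v c)"
    have "f ?t + g ?s = (\<Sum>c\<in>insert d G. scale (a c / c) (f (v c) + scale c (g (v c))))"
      unfolding f.sum g.sum f.scale g.scale sum.distrib[symmetric]
      using nz insert.prems(1) by (intro sum.cong) (auto simp: scale_right_distrib)
    also have "\<dots> \<in> H"
      using fg insert.prems(1) by (intro subspace_sum[OF H] subspace_scale[OF H]) blast
    finally have "f ?t + g ?s \<in> H" .
    moreover have "g ?s \<in> H"
      using insert.prems(2) gH by blast
    ultimately have "f ?t \<in> H"
      using subspace_diff[OF H] by fastforce
    then have t: "?t \<in> H"
      by (rule inj)
    have "?s - scale d ?t = (\<Sum>c\<in>insert d G. scale (a c - d * (a c / c)) (v c))"
      unfolding scale_sum_right sum_subtractf[symmetric]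
      by (intro sum.cong) (auto simp: scale_left_diff_distrib)
    also have "\<dots> = (\<Sum>c\<in>G. scale (a c - d * (a c / c)) (v c))"
      using insert nz[of d] by auto
    finally have "(\<Sum>c\<in>G. scale (a c - d * (a c / c)) (v c)) \<in> H"
      using subspace_diff[OF H insert.prems(2) subspace_scale[OF H t, of d]] by simp
    then have *: "\<forall>c\<in>G. a c - d * (a c / c) = 0"
      using insert.prems(1) by (intro insert.IH) auto
    have G: "\<forall>c\<in>G. a c = 0"
    proof
      fix c assume c: "c \<in> G"
      then have "c \<noteq> 0" "c \<noteq> d"
        using nz[of c] insert by auto
      moreover have "a c * (c - d) = 0"
        using * c \<open>c \<noteq> 0\<close> by (auto simp: field_simps)
      ultimately show "a c = 0" by simp
    qed
    then have "scale (a d) (v d) \<in> H"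
      using insert by (simp add: sum.neutral)
    then have "a d = 0"
      using v[of d] insert.prems(1) subspace_scale[OF H, of "scale (a d) (v d)" "inverse (a d)"]
      by (cases "a d = 0") auto
    with G show ?case by simp
  qed simp
  have H0: "0 \<in> H"
    using H by (rule subspace_0)
  have "card G \<le> dimension" if G: "G \<subseteq> B" "finite G" for G
  proof -
    have injv: "inj_on v G"
    proof (rule inj_onI, rule ccontr)
      fix c d assume cd: "c \<in> G" "d \<in> G" "v c = v d" "c \<noteq> d"
      have "(\<Sum>e\<in>{c, d}. scale (if e = c then 1 else -1) (v e)) \<in> H"
        using cd H0 by simp
      from indep[OF _ _ this] cd G show False by auto
    qed
    have "independent (v ` G)"
    proof
      assume "dependent (v ` G)"
      then obtain u w where u: "w \<in> v ` G" "u w \<noteq> 0" "(\<Sum>w\<in>v ` G. scale (u w) w) = 0"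
        using G by (auto simp: dependent_finite)
      have "(\<Sum>c\<in>G. scale (u (v c)) (v c)) \<in> H"
        using u(3) H0 by (simp add: sum.reindex[OF injv] o_def)
      from indep[OF G(2,1) this] u(1,2) show False by auto
    qed
    then have "card (v ` G) \<le> dim (UNIV :: 'b set)"
      by (intro independent_card_le_dim) auto
    then show ?thesis
      using card_image[OF injv] dim_subset_UNIV[of UNIV] by linarith
  qed
  then show ?thesis
    unfolding B_def[symmetric] using finite_if_finite_subsets_card_bdd by blast
qed

text \<open>The coefficients \<open>w\<close> are independent of \<open>c\<close>, which makes
  vanishing of the power a polynomial condition on \<open>c\<close>.\<close>

lemma funpow_pencil_polynomial:
  assumes f: "Vector_Spaces.linear scale scale f" and g: "Vector_Spaces.linear scale scale g"
  shows "\<exists>w. \<forall>c. ((\<lambda>v. f v + scale c (g v)) ^^ m) h = (\<Sum>i\<le>m. scale (c ^ i) (w i))"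
proof (induction m)
  case 0
  show ?case
    by (rule exI[of _ "\<lambda>_. h"]) simp
next
  case (Suc m)
  interpret f: Vector_Spaces.linear scale scale f by (rule f)
  interpret g: Vector_Spaces.linear scale scale g by (rule g)
  obtain w where w: "\<And>c. ((\<lambda>v. f v + scale c (g v)) ^^ m) h = (\<Sum>i\<le>m. scale (c ^ i) (w i))"
    using Suc by blast
  \<comment> \<open>Applying \<open>f\<close> keeps the exponent of \<open>c\<close>, applying
    \<open>g\<close> raises it by one. The zeros at index \<open>Suc m\<close> in \<open>w1\<close>
    and at index \<open>0\<close> in \<open>w2\<close> give both sums the same range.\<close>
  define w1 where "w1 i = (if i \<le> m then f (w i) else 0)" for i
  define w2 where "w2 i = (case i of 0 \<Rightarrow> 0 | Suc j \<Rightarrow> g (w j))" for i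
  have "((\<lambda>v. f v + scale c (g v)) ^^ Suc m) h = (\<Sum>i\<le>Suc m. scale (c ^ i) (w1 i + w2 i))" for c
  proof -
    have "((\<lambda>v. f v + scale c (g v)) ^^ Suc m) h
        = (\<Sum>i\<le>m. scale (c ^ i) (f (w i))) + (\<Sum>i\<le>m. scale (c ^ Suc i) (g (w i)))"
      by (simp add: w f.sum g.sum f.scale g.scale scale_sum_right)
    also have "(\<Sum>i\<le>m. scale (c ^ i) (f (w i))) = (\<Sum>i\<le>Suc m. scale (c ^ i) (w1 i))"
      by (simp add: w1_def)
    also have "(\<Sum>i\<le>m. scale (c ^ Suc i) (g (w i))) = (\<Sum>i\<le>Suc m. scale (c ^ i) (w2 i))"
      by (simp only: sum.atMost_Suc_shift) (simp add: w2_def)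
    finally show ?thesis
      by (simp only: sum.distrib scale_right_distrib)
  qed
  then show ?case
    by (intro exI[of _ "\<lambda>i. w1 i + w2 i"]) blast
qed

end

section \<open>Coordinates and identities for the bracket\<close>

context fd_complex_lie_algebra
begin

text \<open>The locale \<open>finite_dimensional_vector_space\<close> takes a basis as parameter, so
  one is fixed by choice.\<close>

definition basis :: "'g set" where
  "basis = (SOME B. finite B \<and> independent B \<and> span B = UNIV)"

lemma basis: "finite basis \<and> independent basis \<and> span basis = UNIV"
proof -
  obtain B where B: "finite B" "span B = UNIV"
    using finite_dim by blast
  obtain B' where "B' \<subseteq> B" "independent B'" "B \<subseteq> span B'"
    by (rule maximal_independent_subset)
  then have "finite B' \<and> independent B' \<and> span B' = UNIV"
    using B by (metis finite_subset span_span span_mono top.extremum_uniqueI)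
  then show ?thesis
    unfolding basis_def by (rule someI)
qed

sublocale finite_dimensional_vector_space scale basis
  by unfold_locales (use basis in auto)

text \<open>In coordinates every component is a complex polynomial in \<open>c\<close> with
  infinitely many roots, so all its coefficients vanish and each \<open>w i\<close> is zero.\<close>

lemma vector_polynomial_eq_0:
  assumes inf: "infinite {c. (\<Sum>i\<le>m. scale (c ^ i) (w i)) = 0}"
  shows "(\<Sum>i\<le>m. scale (c ^ i) (w i)) = 0"
proof -
  have rep: "representation basis (\<Sum>i\<le>m. scale (c ^ i) (w i)) b
      = (\<Sum>i\<le>m. representation basis (w i) b * c ^ i)" for b c
    by (simp add: representation_sum representation_scale basis mult.commute)
  have "representation basis (w i) b = 0" if "i \<le> m" for i b
  proof (rule ccontr)
    assume "representation basis (w i) b \<noteq> 0"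
    then have "finite {z. (\<Sum>i\<le>m. representation basis (w i) b * z ^ i) = 0}"
      using that by (intro conjunct1[OF polyfun_rootbound]) 
    moreover have "{c. (\<Sum>i\<le>m. scale (c ^ i) (w i)) = 0}
        \<subseteq> {z. (\<Sum>i\<le>m. representation basis (w i) b * z ^ i) = 0}"
      using rep by (auto simp: representation_zero rep[symmetric])
    ultimately show False
      using inf finite_subset by blast
  qed
  then have "representation basis (w i) = representation basis 0" if "i \<le> m" for i
    using that by (auto simp: representation_zero)
  then have "w i = 0" if "i \<le> m" for i
    using that sum_representation_eq[of basis "w i" basis] basis
    by (metis (no_types, lifting) UNIV_I order_refl representation_zero scale_zero_left sum.neutral)
  then show ?thesis by simp
qed

lemma linear_bracket: "Vector_Spaces.linear scale scale (bracket x)"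
  by unfold_locales (auto simp: bracket_add_right bracket_scale_right)

lemma linear_bracket_left: "Vector_Spaces.linear scale scale (\<lambda>x. bracket x y)"
  by unfold_locales (auto simp: bracket_add_left bracket_scale_left)

interpretation ad: Vector_Spaces.linear scale scale "bracket x" for x
  by (rule linear_bracket)

interpretation ad_left: Vector_Spaces.linear scale scale "\<lambda>x. bracket x y" for y
  by (rule linear_bracket_left)

interpretation ad_pow: Vector_Spaces.linear scale scale "bracket x ^^ n" for x n
  by (rule linear_funpow[OF linear_bracket])

lemma bracket_anticomm: "bracket x y = - bracket y x"
proof -
  have "bracket x y + bracket y x = 0"
    using bracket_self[of "x + y"] unfolding bracket_add_left bracket_add_right
    by (simp add: bracket_self add.commute)
  then show ?thesis
    by (simp add: eq_neg_iff_add_eq_0)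
qed

lemma bracket_derivation:
  "bracket x (bracket y z) = bracket (bracket x y) z + bracket y (bracket x z)"
proof -
  have "bracket z (bracket x y) = - bracket (bracket x y) z"
    "bracket y (bracket z x) = - bracket y (bracket x z)"
    using bracket_anticomm[of z "bracket x y"] bracket_anticomm[of z x] ad.neg by auto
  then show ?thesis
    using jacobi[of x y z] by (simp add: algebra_simps)
qed

section \<open>Engel's theorem\<close>

text \<open>Stating the induction property for all pairs \<open>W \<subset> V\<close> of invariant subspaces
  replaces the quotient modules of the usual proof of Engel's theorem.\<close>

lemma engel_relative:
  assumes A: "subalgebra A" and nil: "\<And>y z. y \<in> A \<Longrightarrow> z \<in> A \<Longrightarrow> \<exists>n. (bracket y ^^ n) z = 0"
    and V: "subspace V" "V \<subseteq> A" "\<And>y v. y \<in> A \<Longrightarrow> v \<in> V \<Longrightarrow> bracket y v \<in> V"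
    and W: "subspace W" "W \<subset> V" "\<And>y v. y \<in> A \<Longrightarrow> v \<in> W \<Longrightarrow> bracket y v \<in> W"
  shows "\<exists>v\<in>V - W. \<forall>y\<in>A. bracket y v \<in> W"
proof -
  define P where "P K \<longleftrightarrow> subalgebra K \<and> K \<subseteq> A \<and>
    (\<forall>W V. subspace W \<and> subspace V \<and> W \<subset> V \<and> V \<subseteq> A \<and>
      (\<forall>y\<in>K. \<forall>v\<in>V. bracket y v \<in> V) \<and> (\<forall>y\<in>K. \<forall>v\<in>W. bracket y v \<in> W) \<longrightarrow>
      (\<exists>v\<in>V - W. \<forall>y\<in>K. bracket y v \<in> W))" for K
  have A0: "0 \<in> A"
    using A by (simp add: subalgebra_def subspace_0)
  have "P {0}"
    unfolding P_def subalgebra_def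
    using A0 by (auto simp: ad_left.zero subspace_0)
  \<comment> \<open>A subalgebra of largest dimension with \<open>P\<close> will turn out to be
    \<open>A\<close>, since any smaller one can be enlarged by one dimension.\<close>
  then obtain M where M: "P M" and max: "\<And>K. P K \<Longrightarrow> dim K \<le> dim M"
    using ex_has_greatest_nat[of P "{0}" dim "Suc dimension"] dim_subset_UNIV
    by (auto simp: less_Suc_eq_le)
  have M': "subspace M" "M \<subseteq> A" "\<And>y z. y \<in> M \<Longrightarrow> z \<in> M \<Longrightarrow> bracket y z \<in> M"
    using M by (auto simp: P_def subalgebra_def)
  have "M = A"
  proof (rule ccontr)
    assume "M \<noteq> A"
    then have "M \<subset> A"
      using M'(2) by blast
    moreover have "\<forall>y\<in>M. \<forall>v\<in>A. bracket y v \<in> A" "\<forall>y\<in>M. \<forall>v\<in>M. bracket y v \<in> M"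
      using A M' by (auto simp: subalgebra_def)
    \<comment> \<open>Property \<open>P M\<close> is used for the pair \<open>M \<subset> A\<close>
      itself: the resulting \<open>z\<close> normalizes \<open>M\<close>, so \<open>M\<close> and
      \<open>z\<close> together span a larger subalgebra.\<close>
    ultimately have "\<exists>z\<in>A - M. \<forall>m\<in>M. bracket m z \<in> M"
      using M[unfolded P_def, THEN conjunct2, THEN conjunct2, rule_format, of M A] M'(1) A
      by (simp add: subalgebra_def)
    then obtain z where z: "z \<in> A" "z \<notin> M" "\<And>m. m \<in> M \<Longrightarrow> bracket m z \<in> M"
      by blast
    define M1 where "M1 = span (insert z M)"
    have M1_eq: "M1 = {m + scale c z | m c. m \<in> M}"
      unfolding M1_def span_insert span_eq_iff[THEN iffD2, OF M'(1)]
      by (auto intro: exI[of _ "_ - _"] diff_add_cancel[symmetric])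
         (metis add_diff_cancel_right')
    have M1_A: "M1 \<subseteq> A"
      unfolding M1_def using z(1) M'(2) A by (intro span_minimal) (auto simp: subalgebra_def)
    have "bracket x y \<in> M1" if "x \<in> M1" "y \<in> M1" for x y
    proof -
      obtain m c where x: "x = m + scale c z" "m \<in> M"
        using \<open>x \<in> M1\<close> unfolding M1_eq by blast
      obtain n d where y: "y = n + scale d z" "n \<in> M"
        using \<open>y \<in> M1\<close> unfolding M1_eq by blast
      note xy = x y
      have "bracket x y = bracket m n + scale d (bracket m z) - scale c (bracket n z)"
        using bracket_anticomm[of z n]
        by (simp add: xy bracket_add_left bracket_add_right bracket_scale_left
            bracket_scale_right bracket_self)
      moreover have "\<dots> \<in> M"
        using M' xy z(3) by (intro subspace_add subspace_diff subspace_scale) auto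
      moreover have "M \<subseteq> M1"
        unfolding M1_def by (auto intro: span_base)
      ultimately show ?thesis by auto
    qed
    then have sub: "subalgebra M1"
      by (simp add: subalgebra_def M1_def)
    have "P M1"
      unfolding P_def
    proof (intro conjI sub M1_A allI impI, elim conjE)
      fix W V
      assume W: "subspace W" and V: "subspace V" and WV: "W \<subset> V" "V \<subseteq> A"
        and inv: "\<forall>y\<in>M1. \<forall>v\<in>V. bracket y v \<in> V" "\<forall>y\<in>M1. \<forall>v\<in>W. bracket y v \<in> W"
      have M_M1: "M \<subseteq> M1" and z_M1: "z \<in> M1"
        unfolding M1_def by (auto intro: span_base)
      have "\<exists>u\<in>V - W. \<forall>y\<in>M. bracket y u \<in> W"
        using M[unfolded P_def, THEN conjunct2, THEN conjunct2, rule_format, of W V] W V WV inv M_M1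
        by blast
      then obtain u where u: "u \<in> V" "u \<notin> W" "\<forall>y\<in>M. bracket y u \<in> W"
        by blast
      \<comment> \<open>The vectors of \<open>V\<close> sent into \<open>W\<close> by all of
        \<open>M\<close> are stable under \<open>z\<close>, because \<open>bracket y z\<close> stays
        in \<open>M\<close>. As \<open>z\<close> acts nilpotently, the last iterate of
        \<open>u\<close> outside \<open>W\<close> is sent into \<open>W\<close> by \<open>z\<close>
        too.\<close>
      obtain n where "(bracket z ^^ n) u = 0"
        using nil z(1) u(1) WV(2) by blast
      then have "\<exists>n. (bracket z ^^ n) u \<in> W"
        using subspace_0[OF W] by metis
      then obtain n where n: "(bracket z ^^ n) u \<notin> W" "(bracket z ^^ Suc n) u \<in> W"
        using exists_least_lemma[of "\<lambda>n. (bracket z ^^ n) u \<in> W"] u(2) by auto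
      define v where "v = (bracket z ^^ n) u"
      have "(bracket z ^^ k) u \<in> V \<and> (\<forall>y\<in>M. bracket y ((bracket z ^^ k) u) \<in> W)" for k
      proof (induction k)
        case 0
        show ?case using u by simp
      next
        case (Suc k)
        let ?u = "(bracket z ^^ k) u"
        have "bracket y (bracket z ?u) \<in> W" if y: "y \<in> M" for y
        proof -
          have "bracket (bracket y z) ?u \<in> W" "bracket z (bracket y ?u) \<in> W"
            using Suc y z(3) inv(2) z_M1 by auto
          then show ?thesis
            unfolding bracket_derivation[of y z] by (rule subspace_add[OF W])
        qed
        then show ?case
          using Suc inv(1) z_M1 by simp
      qed
      then have v: "v \<in> V" "\<And>y. y \<in> M \<Longrightarrow> bracket y v \<in> W"
        by (auto simp: v_def)
      have "bracket y v \<in> W" if "y \<in> M1" for y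
      proof -
        obtain m c where "y = m + scale c z" "m \<in> M"
          using \<open>y \<in> M1\<close> by (auto simp: M1_eq)
        then show ?thesis
          using v(2)[of m] n(2) W
          by (auto simp: bracket_add_left bracket_scale_left v_def intro: subspace_add subspace_scale)
      qed
      then show "\<exists>v\<in>V - W. \<forall>y\<in>M1. bracket y v \<in> W"
        using v(1) n(1) by (auto simp: v_def)
    qed
    then have "dim M1 \<le> dim M"
      by (rule max)
    moreover have "dim M < dim M1"
      using z(2) M'(1) unfolding M1_def
      by (intro dim_psubset) (auto simp: span_eq_iff[THEN iffD2] intro: span_base)
    ultimately show False by simp
  qed
  then show ?thesis
    using M[unfolded P_def, THEN conjunct2, THEN conjunct2, rule_format, of W V] V W by blast
qed

text \<open>The upper central series \<open>W\<close> is stationary from index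
  \<open>dimension\<close> on. If it stopped below \<open>A\<close>, \<open>engel_relative\<close>
  for the pair \<open>W dimension \<subset> A\<close> would produce a new element of the next
  term.\<close>

theorem engel:
  assumes A: "subalgebra A" and nil: "\<And>y z. y \<in> A \<Longrightarrow> z \<in> A \<Longrightarrow> \<exists>n. (bracket y ^^ n) z = 0"
  shows "nilpotent A"
proof -
  define W where "W = rec_nat {0} (\<lambda>_ U. {v \<in> A. \<forall>y\<in>A. bracket y v \<in> U})"
  have W_0: "W 0 = {0}" and W_Suc: "W (Suc i) = {v \<in> A. \<forall>y\<in>A. bracket y v \<in> W i}" for i
    by (simp_all add: W_def)
  have A': "subspace A" "\<And>y z. y \<in> A \<Longrightarrow> z \<in> A \<Longrightarrow> bracket y z \<in> A"
    using A by (auto simp: subalgebra_def)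
  have sub: "subspace (W i)" for i
  proof (induction i)
    case (Suc i)
    then show ?case
      using A'(1) by (auto simp: W_Suc subspace_def ad.zero ad.add ad.scale)
  qed (simp add: W_0)
  have mono: "W i \<subseteq> W (Suc i)" for i
  proof (induction i)
    case 0
    show ?case
      using subspace_0[OF A'(1)] by (auto simp: W_0 W_Suc ad.zero)
  next
    case (Suc i)
    then show ?case
      by (auto simp: W_Suc[of "Suc i"] W_Suc[of i])
  qed
  have W_A: "W i \<subseteq> A" for i
    using mono[of i] by (auto simp: W_Suc)
  have "W (Suc dimension) \<subseteq> W dimension"
    by (rule subspace_chain_stabilises[of W, OF sub mono]) (simp add: W_Suc)
  then have stable: "W (Suc dimension) = W dimension"
    using mono by blast
  have top: "W dimension = A"
  proof (rule ccontr)
    assume "W dimension \<noteq> A"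
    then have "\<exists>v\<in>A - W dimension. \<forall>y\<in>A. bracket y v \<in> W dimension"
      using A A' nil sub W_A stable by (intro engel_relative) (auto simp: W_Suc)
    then show False
      using stable by (auto simp: W_Suc)
  qed
  \<comment> \<open>Each bracket with \<open>A\<close> goes down one term of \<open>W\<close>, so
    the lower central series reaches \<open>W 0\<close> after \<open>dimension\<close>
    steps.\<close>
  have "lower_central A k \<subseteq> W (dimension - k)" if "k \<le> dimension" for k
    using that
  proof (induction k)
    case (Suc k)
    have "dimension - k = Suc (dimension - Suc k)"
      using Suc.prems by simp
    then have "lower_central A k \<subseteq> W (Suc (dimension - Suc k))"
      using Suc by simp
    then show ?case
      unfolding lower_central.simps by (intro span_minimal sub) (auto simp: W_Suc)
  qed (simp add: top)
  from this[of dimension] have "lower_central A dimension \<subseteq> {0}"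
    by (simp add: W_0)
  moreover have "0 \<in> lower_central A n" for n
    by (cases n) (auto simp: subspace_0[OF A'(1)] span_zero)
  ultimately have "lower_central A dimension = {0}"
    by blast
  then show ?thesis
    unfolding nilpotent_def by blast
qed

section \<open>Null components and the existence of Cartan subalgebras\<close>

text \<open>This is the Fitting null component of \<open>ad x\<close>, its generalized eigenspace
  for 0. The exponent may depend on \<open>y\<close> here; \<open>null_component_iff\<close> makes
  it uniform.\<close>

definition null_component :: "'g \<Rightarrow> 'g set" where
  "null_component x = {y. \<exists>n. (bracket x ^^ n) y = 0}"

lemma null_component_iff: "y \<in> null_component x \<longleftrightarrow> (bracket x ^^ dimension) y = 0"
  unfolding null_component_def
  using funpow_eq_0_imp_funpow_dimension_eq_0[OF linear_bracket] by blast

lemma self_in_null_component: "x \<in> null_component x"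
  unfolding null_component_def using bracket_self by (auto intro: exI[of _ 1])

text \<open>From right to left the null component is stable under \<open>ad x\<close>; from left to
  right \<open>ad x\<close> is injective modulo it, which both the normalizer and the pencil
  argument need.\<close>

lemma bracket_in_null_component_iff:
  "bracket x y \<in> null_component x \<longleftrightarrow> y \<in> null_component x"
proof
  assume "bracket x y \<in> null_component x"
  then obtain n where "(bracket x ^^ Suc n) y = 0"
    unfolding null_component_def funpow_Suc_right by auto
  then show "y \<in> null_component x"
    unfolding null_component_def by blast
next
  assume "y \<in> null_component x"
  then have "bracket x ((bracket x ^^ dimension) y) = 0"
    by (simp add: null_component_iff ad.zero)
  then show "bracket x y \<in> null_component x"
    by (simp add: null_component_iff funpow_swap1)
qed

text \<open>By the Leibniz rule, \<open>m + n\<close> applications of \<open>ad x\<close> to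
  \<open>bracket y z\<close> hit \<open>y\<close> at least \<open>m\<close> times or
  \<open>z\<close> at least \<open>n\<close> times in every term. Induction on \<open>m + n\<close>
  avoids the binomial formula.\<close>

lemma subalgebra_null_component: "subalgebra (null_component x)"
proof -
  have "(bracket x ^^ (m + n)) (bracket y z) = 0"
    if "(bracket x ^^ m) y = 0" "(bracket x ^^ n) z = 0" for m n y z
    using that
  proof (induction "m + n" arbitrary: m n y z)
    case 0
    then show ?case by (simp add: ad.zero)
  next
    case (Suc k)
    show ?case
    proof (cases "m = 0 \<or> n = 0")
      case True
      then have "bracket y z = 0"
        using Suc.prems by (auto simp: ad.zero ad_left.zero)
      then show ?thesis
        by (simp add: ad_pow.zero)
    next
      case False
      then obtain m' n' where mn: "m = Suc m'" "n = Suc n'"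
        by (meson not0_implies_Suc)
      have "(bracket x ^^ m') (bracket x y) = 0" "(bracket x ^^ n') (bracket x z) = 0"
        using Suc.prems by (simp_all add: mn funpow_swap1)
      then have "(bracket x ^^ k) (bracket (bracket x y) z) = 0"
        "(bracket x ^^ k) (bracket y (bracket x z)) = 0"
        using Suc.hyps(1)[of m' n "bracket x y" z] Suc.hyps(1)[of m n' y "bracket x z"]
          Suc.hyps(2) Suc.prems by (simp_all add: mn)
      then have "(bracket x ^^ k) (bracket x (bracket y z)) = 0"
        by (simp add: bracket_derivation[of x y z] ad_pow.add)
      then show ?thesis
        unfolding Suc.hyps(2)[symmetric] funpow_Suc_right by simp
    qed
  qed
  moreover have "subspace (null_component x)"
    by (auto simp: subspace_def null_component_iff ad_pow.zero ad_pow.add ad_pow.scale)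
  ultimately show ?thesis
    unfolding subalgebra_def null_component_def by blast
qed

text \<open>Since \<open>x\<close> lies in its own null component, a normalizing \<open>y\<close>
  has \<open>bracket x y\<close> there, and injectivity modulo the component puts \<open>y\<close>
  there.\<close>

lemma normalizer_null_component: "normalizer (null_component x) = null_component x"
proof
  show "normalizer (null_component x) \<subseteq> null_component x"
  proof
    fix y assume "y \<in> normalizer (null_component x)"
    then have "bracket y x \<in> null_component x"
      using self_in_null_component by (auto simp: normalizer_def)
    then have "bracket x y \<in> null_component x"
      using subalgebra_null_component[of x] bracket_anticomm[of x y]
      by (auto simp: subalgebra_def dest: subspace_neg)
    then show "y \<in> null_component x"
      by (simp add: bracket_in_null_component_iff)
  qed
  show "null_component x \<subseteq> normalizer (null_component x)"
    using subalgebra_null_component[of x] by (auto simp: subalgebra_def normalizer_def)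
qed

text \<open>If \<open>null_component x\<close> has minimal dimension and contains \<open>y\<close>, then \<open>x + c (y - x)\<close> acts
  injectively modulo it for all but finitely many \<open>c\<close>. For those \<open>c\<close> minimality makes
  \<open>x + c (y - x)\<close> act nilpotently on it, a condition that is polynomial in \<open>c\<close> and
  therefore also holds at \<open>c = 1\<close>.\<close>


theorem cartan_subalgebra_exists: "\<exists>H. cartan_subalgebra H"
proof -
  obtain x where min: "\<And>z. dim (null_component x) \<le> dim (null_component z)"
    using ex_has_least_nat[where P = "\<lambda>_. True" and m = "\<lambda>x. dim (null_component x)"] by blast
  define H where "H = null_component x"
  have H: "subspace H" "\<And>y z. y \<in> H \<Longrightarrow> z \<in> H \<Longrightarrow> bracket y z \<in> H" "x \<in> H"
    using subalgebra_null_component[of x] self_in_null_component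
    by (auto simp: H_def subalgebra_def)
  have "\<exists>n. (bracket y ^^ n) h = 0" if y: "y \<in> H" and h: "h \<in> H" for y h
  proof -
    let ?z = "\<lambda>c. x + scale c (y - x)"
    have ad_z: "bracket (?z c) = (\<lambda>v. bracket x v + scale c (bracket (y - x) v))" for c
      by (simp add: fun_eq_iff bracket_add_left bracket_scale_left)
    obtain w where w: "\<And>c. (bracket (?z c) ^^ dimension) h = (\<Sum>i\<le>dimension. scale (c ^ i) (w i))"
      using funpow_pencil_polynomial[OF linear_bracket linear_bracket, of dimension x "y - x" h]
      unfolding ad_z by blast
    let ?B = "{c. \<exists>v. v \<notin> H \<and> bracket x v + scale c (bracket (y - x) v) \<in> H}"
    have "finite ?B"
    proof (rule finite_singular_pencil[OF linear_bracket linear_bracket H(1)])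
      show "bracket (y - x) ` H \<subseteq> H"
        using H y by (auto intro: subspace_diff)
      show "bracket x v \<in> H \<Longrightarrow> v \<in> H" for v
        by (simp add: H_def bracket_in_null_component_iff)
    qed
    moreover have "(bracket (?z c) ^^ dimension) h = 0" if c: "c \<notin> ?B" for c
    proof -
      have "null_component (?z c) \<subseteq> H"
      proof
        fix v assume v: "v \<in> null_component (?z c)"
        show "v \<in> H"
        proof (rule ccontr)
          assume "v \<notin> H"
          \<comment> \<open>Injectivity of \<open>ad (?z c)\<close> modulo \<open>H\<close> keeps
            all iterates outside \<open>H\<close>, so none of them is zero.\<close>
          then have "(bracket (?z c) ^^ n) v \<notin> H" for n
            by (induction n) (use c ad_z in auto)
          then show False
            using v subspace_0[OF H(1)] unfolding null_component_iff by metis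
        qed
      qed
      then have "null_component (?z c) = H"
        using min[of "?z c"] H(1) subalgebra_null_component[of "?z c"]
        by (intro subspace_dim_equal) (auto simp: H_def subalgebra_def)
      then show ?thesis
        using h null_component_iff by blast
    qed
    ultimately have "finite (- {c. (\<Sum>i\<le>dimension. scale (c ^ i) (w i)) = 0})"
      by (elim finite_subset[rotated]) (auto simp: w)
    then have "infinite {c. (\<Sum>i\<le>dimension. scale (c ^ i) (w i)) = 0}"
      using infinite_UNIV_char_0[where 'a = complex] by (metis finite_compl)
    then have "(\<Sum>i\<le>dimension. scale (1 ^ i) (w i)) = 0"
      by (rule vector_polynomial_eq_0)
    then have "(bracket (?z 1) ^^ dimension) h = 0"
      by (simp only: w)
    then show ?thesis
      by auto
  qed
  then have "nilpotent H"
    using subalgebra_null_component[of x] by (intro engel) (auto simp: H_def)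
  then show ?thesis
    using subalgebra_null_component normalizer_null_component
    unfolding cartan_subalgebra_def H_def by blast
qed

section \<open>Ideals as adjoint modules\<close>

text \<open>Modules live on subspaces of \<open>cseq\<close>, so the adjoint modules must be moved
  there; the embedding takes coordinates with respect to a numbered basis.\<close>

lemma linear_embedding_exists:
  "\<exists>\<phi>. Vector_Spaces.linear scale cseq_scale \<phi> \<and> inj \<phi>"
proof -
  obtain f :: "'g \<Rightarrow> nat" where f: "inj_on f basis"
    using basis finite_imp_inj_to_nat_seg by metis
  define \<phi> where
    "\<phi> x = (\<lambda>i. if i \<in> f ` basis then representation basis x (inv_into basis f i) else 0)" for x
  have add: "\<phi> (x + y) = \<phi> x + \<phi> y" for x y
    by (simp add: \<phi>_def fun_eq_iff representation_add basis)
  have scale: "\<phi> (scale c x) = cseq_scale c (\<phi> x)" for c x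
    by (simp add: \<phi>_def cseq_scale_def fun_eq_iff representation_scale basis)
  have "Vector_Spaces.linear scale cseq_scale \<phi>"
    by unfold_locales (use add scale in auto)
  moreover have "inj \<phi>"
  proof (rule injI)
    fix x y assume "\<phi> x = \<phi> y"
    then have "representation basis x b = representation basis y b" if "b \<in> basis" for b
      using that f unfolding \<phi>_def fun_eq_iff
      by (metis (no_types, lifting) imageI inv_into_f_f)
    then have "(\<Sum>b\<in>basis. scale (representation basis x b) b)
        = (\<Sum>b\<in>basis. scale (representation basis y b) b)"
      by (intro sum.cong) auto
    then show "x = y"
      using basis by (simp add: sum_representation_eq)
  qed
  ultimately show ?thesis by blast
qed

lemma ideal_direct_summand:
  assumes L: "direct_sum k L" and i: "i \<in> {1..k}"
  shows "ideal_of (L i) UNIV"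
  unfolding ideal_of_def
proof (intro conjI ballI)
  show sub: "subspace (L i)"
    using assms by (auto simp: direct_sum_def subalgebra_def)
  fix x y assume y: "y \<in> L i"
  obtain f where f: "f \<in> (\<Pi>\<^sub>E j\<in>{1..k}. L j)" "x = (\<Sum>j\<in>{1..k}. f j)"
    using L unfolding direct_sum_def by blast
  have "bracket (f j) y \<in> L i" if j: "j \<in> {1..k}" for j
  proof (cases "j = i")
    case True
    then show ?thesis
      using L i y PiE_mem[OF f(1) j] by (auto simp: direct_sum_def subalgebra_def)
  next
    case False
    then have "bracket (f j) y = 0"
      using L i j y PiE_mem[OF f(1) j] unfolding direct_sum_def by blast
    then show ?thesis
      using subspace_0[OF sub] by simp
  qed
  then show "bracket x y \<in> L i"
    unfolding f(2) ad_left.sum by (intro subspace_sum[OF sub])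
qed simp

definition ad_action :: "('g \<Rightarrow> cseq) \<Rightarrow> 'g \<Rightarrow> cseq \<Rightarrow> cseq" where
  "ad_action \<phi> x v = \<phi> (bracket x (inv \<phi> v))"

context
  fixes \<phi> :: "'g \<Rightarrow> cseq"
  assumes \<phi>: "Vector_Spaces.linear scale cseq_scale \<phi>" and inj: "inj \<phi>"
begin

interpretation \<phi>: Vector_Spaces.linear scale cseq_scale \<phi>
  by (rule \<phi>)

lemma ad_action_embed: "ad_action \<phi> x (\<phi> y) = \<phi> (bracket x y)"
  by (simp add: ad_action_def inj)

lemma lie_module_ideal:
  assumes I: "ideal_of I UNIV"
  shows "lie_module (\<phi> ` I) (ad_action \<phi>)"
proof -
  have I': "subspace I" "\<And>x y. y \<in> I \<Longrightarrow> bracket x y \<in> I"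
    using I by (auto simp: ideal_of_def)
  obtain B where "finite B" "span B = I"
    by (metis I'(1) basis_subspace_exists finiteI_independent span_subspace)
  then have "finite (\<phi> ` B) \<and> cseq.span (\<phi> ` B) = \<phi> ` I"
    by (simp add: \<phi>.span_image)
  then have "\<exists>B. finite B \<and> cseq.span B = \<phi> ` I"
    by blast
  moreover have "bracket (bracket x y) z = bracket x (bracket y z) - bracket y (bracket x z)" for x y z
    by (simp add: bracket_derivation[of x y z])
  ultimately show ?thesis
    unfolding lie_module_def
    using I'(2)
    by (auto simp: ad_action_embed \<phi>.add[symmetric] \<phi>.scale[symmetric] \<phi>.diff[symmetric]
        ad.add ad.scale ad_left.add ad_left.scale)
qed

text \<open>The preimage of \<open>W\<close> under \<phi> is an ideal of \<open>I\<close>, since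
  \<open>S\<close> contains \<open>I\<close>. Taking \<open>S = UNIV\<close> gives simplicity of the
  module, and \<open>S = I\<close> gives its indecomposability over \<open>I\<close>.\<close>

lemma submodule_ideal_cases:
  assumes I: "simple I" "I \<subseteq> S" and W: "submodule S (\<phi> ` I) (ad_action \<phi>) W"
  shows "W = {0} \<or> W = \<phi> ` I"
proof -
  define J where "J = {y. \<phi> y \<in> W}"
  have W': "cseq.subspace W" "W \<subseteq> \<phi> ` I"
    and inv: "\<And>x w. x \<in> S \<Longrightarrow> w \<in> W \<Longrightarrow> ad_action \<phi> x w \<in> W"
    using W by (auto simp: submodule_def)
  have WJ: "W = \<phi> ` J"
    using W'(2) by (auto simp: J_def)
  have "subspace J"
    using W'(1) unfolding J_def subspace_def
    by (auto simp: \<phi>.zero \<phi>.add \<phi>.scale cseq.subspace_0 cseq.subspace_add cseq.subspace_scale)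
  moreover have "J \<subseteq> I"
    using W'(2) inj by (auto simp: J_def dest: injD)
  moreover have "bracket x y \<in> J" if "x \<in> I" "y \<in> J" for x y
    using inv[of x "\<phi> y"] that I(2) by (auto simp: J_def ad_action_embed)
  ultimately have "ideal_of J I"
    by (simp add: ideal_of_def)
  then have "J = {0} \<or> J = I"
    using I(1) by (simp add: simple_def)
  then show ?thesis
    using WJ by (auto simp: \<phi>.zero)
qed

lemma simple_moduleI:
  assumes "simple I" "ideal_of I UNIV"
  shows "simple_module (\<phi> ` I) (ad_action \<phi>)" "\<not> trivial_module (\<phi> ` I) (ad_action \<phi>)"
proof -
  obtain x y where xy: "x \<in> I" "y \<in> I" "bracket x y \<noteq> 0"
    using assms(1) by (auto simp: simple_def)
  then have "\<phi> (bracket x y) \<noteq> 0"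
    using inj \<phi>.zero by (metis injD)
  then have ne: "ad_action \<phi> x (\<phi> y) \<noteq> 0"
    by (simp add: ad_action_embed)
  then show "\<not> trivial_module (\<phi> ` I) (ad_action \<phi>)"
    using xy(2) unfolding trivial_module_def by blast
  have "y \<noteq> 0"
    using xy(3) by (auto simp: ad.zero)
  then have "\<phi> y \<noteq> 0"
    using inj \<phi>.zero by (metis injD)
  then have "\<phi> ` I \<noteq> {0}"
    using xy(2) by blast
  then show "simple_module (\<phi> ` I) (ad_action \<phi>)"
    using submodule_ideal_cases[OF assms(1) subset_UNIV] lie_module_ideal[OF assms(2)]
    unfolding simple_module_def by blast
qed

text \<open>Two nonzero \<open>I\<close>-submodules of the adjoint module \<open>I\<close> both
  equal the whole module, so they cannot meet in zero.\<close>

lemma not_narrow_simple_ideal: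
  assumes "simple I" "ideal_of I UNIV"
  shows "\<not> narrow I"
proof
  assume "narrow I"
  then have "decomposable I (\<phi> ` I) (ad_action \<phi>)"
    using simple_moduleI[OF assms] unfolding narrow_def by blast
  then obtain W1 W2 where "submodule I (\<phi> ` I) (ad_action \<phi>) W1"
    "submodule I (\<phi> ` I) (ad_action \<phi>) W2" "W1 \<noteq> {0}" "W2 \<noteq> {0}" "W1 \<inter> W2 = {0}"
    unfolding decomposable_def by blast
  then show False
    using submodule_ideal_cases[OF assms(1) subset_refl] by blast
qed

text \<open>\<open>S\<close> acts on the adjoint module \<open>I\<close> by zero, so any splitting
  of the vector space is one of modules. Elements \<open>x\<close>, \<open>y\<close> of
  \<open>I\<close> with nonzero bracket are not proportional, which supplies the required two
  dimensions.\<close>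

lemma not_wide_commuting:
  assumes I: "simple I" "ideal_of I UNIV" and S: "\<And>x y. x \<in> S \<Longrightarrow> y \<in> I \<Longrightarrow> bracket x y = 0"
  shows "\<not> wide S"
proof -
  obtain x y where xy: "x \<in> I" "y \<in> I" "bracket x y \<noteq> 0"
    using I(1) by (auto simp: simple_def)
  have "subspace I"
    using I(2) by (simp add: ideal_of_def)
  then have V: "cseq.subspace (\<phi> ` I)"
    by (rule \<phi>.subspace_image)
  have "x \<noteq> 0"
    using xy(3) by (auto simp: ad_left.zero)
  then have x0: "\<phi> x \<noteq> 0"
    using inj \<phi>.zero by (metis injD)
  have "\<phi> y \<notin> cseq.span {\<phi> x}"
  proof
    assume "\<phi> y \<in> cseq.span {\<phi> x}"
    then obtain c where "\<phi> y = \<phi> (scale c x)"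
      by (auto simp: cseq.span_singleton \<phi>.scale)
    then have "y = scale c x"
      using inj by (rule injD[rotated])
    then show False
      using xy(3) by (simp add: bracket_scale_right bracket_self)
  qed
  then obtain W1 W2 where W: "cseq.subspace W1" "cseq.subspace W2" "W1 \<noteq> {0}" "W2 \<noteq> {0}"
    "W1 \<inter> W2 = {0}" "\<phi> ` I = {w1 + w2 | w1 w2. w1 \<in> W1 \<and> w2 \<in> W2}"
    using cseq.subspace_proper_decomposition[OF V, of "\<phi> x" "\<phi> y"] xy x0 by blast
  have sub: "W1 \<subseteq> \<phi> ` I" "W2 \<subseteq> \<phi> ` I"
  proof -
    have "w = w + 0" "w = 0 + w" for w :: cseq
      by simp_all
    then show "W1 \<subseteq> \<phi> ` I" "W2 \<subseteq> \<phi> ` I"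
      unfolding W(6) using cseq.subspace_0[OF W(1)] cseq.subspace_0[OF W(2)] by blast+
  qed
  have "ad_action \<phi> x v = 0" if "x \<in> S" "v \<in> \<phi> ` I" for x v
    using that S by (auto simp: ad_action_embed \<phi>.zero)
  then have "submodule S (\<phi> ` I) (ad_action \<phi>) W1" "submodule S (\<phi> ` I) (ad_action \<phi>) W2"
    using sub W(1,2) unfolding submodule_def by (auto simp: subset_iff cseq.subspace_0)
  then have "decomposable S (\<phi> ` I) (ad_action \<phi>)"
    using W(3-6) unfolding decomposable_def by blast
  then show ?thesis
    using simple_moduleI(1)[OF I] unfolding wide_def indecomposable_def by blast
qed

end

section \<open>The regular subalgebra that is neither narrow nor wide\<close>

text \<open>The normalizer of an ideal is the whole algebra, so any Cartan subalgebra will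
  do.\<close>

lemma regular_subalgebra_ideal:
  assumes "ideal_of I UNIV"
  shows "regular_subalgebra I"
  using assms cartan_subalgebra_exists
  unfolding regular_subalgebra_def ideal_of_def subalgebra_def normalizer_def by blast

lemma direct_sum_not_extreme:
  assumes k: "k > 1" and L: "direct_sum k L" and simple: "\<forall>i\<in>{1..k}. simple (L i)"
  shows "\<exists>S. regular_subalgebra S \<and> \<not> narrow S \<and> \<not> wide S"
proof -
  obtain \<phi> where \<phi>: "Vector_Spaces.linear scale cseq_scale \<phi>" "inj \<phi>"
    using linear_embedding_exists by blast
  have mem: "1 \<in> {1..k}" "2 \<in> {1..k}"
    using k by auto
  have "bracket x y = 0" if "x \<in> L 1" "y \<in> L 2" for x y
    using L mem that unfolding direct_sum_def by (metis one_eq_numeral_iff semiring_norm(83))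
  then have "\<not> wide (L 1)"
    using not_wide_commuting[OF \<phi> bspec[OF simple mem(2)] ideal_direct_summand[OF L mem(2)]]
    by blast
  moreover have "\<not> narrow (L 1)"
    using not_narrow_simple_ideal[OF \<phi> bspec[OF simple mem(1)] ideal_direct_summand[OF L mem(1)]] .
  ultimately show ?thesis
    using regular_subalgebra_ideal[OF ideal_direct_summand[OF L mem(1)]] by blast
qed

text \<open>This rules out a decomposition with a single simple summand when the algebra is not
  simple.\<close>

lemma direct_sum_1_imp_UNIV:
  assumes "direct_sum 1 L"
  shows "L 1 = UNIV"
proof -
  have "x \<in> L 1" for x
  proof -
    obtain f where "f \<in> (\<Pi>\<^sub>E j\<in>{1..1}. L j)" "x = (\<Sum>j\<in>{1..1::nat}. f j)"
      using assms unfolding direct_sum_def by blast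
    then show ?thesis by auto
  qed
  then show ?thesis by blast
qed

end

theorem theorem4p1:
  fixes scale :: "complex \<Rightarrow> 'g::ab_group_add \<Rightarrow> 'g"
    and bracket :: "'g \<Rightarrow> 'g \<Rightarrow> 'g"
  assumes "fd_complex_lie_algebra scale bracket"
  shows "(fd_complex_lie_algebra.semisimple scale bracket \<and>
          \<not> fd_complex_lie_algebra.simple scale bracket UNIV \<longrightarrow>
          \<not> fd_complex_lie_algebra.regular_extreme scale bracket) \<and>
         (\<forall>k L. k > 1 \<and> fd_complex_lie_algebra.direct_sum scale bracket k L \<and>
            (\<forall>i\<in>{1..k}. fd_complex_lie_algebra.simple scale bracket (L i)) \<longrightarrow>
            (\<exists>S. fd_complex_lie_algebra.regular_subalgebra scale bracket S \<and>
               \<not> fd_complex_lie_algebra.narrow scale bracket S \<and>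
               \<not> fd_complex_lie_algebra.wide scale bracket S))"
proof -
  interpret fd_complex_lie_algebra scale bracket
    by (rule assms)
  have "\<not> regular_extreme" if ss: "semisimple" and ns: "\<not> simple UNIV"
  proof -
    obtain k L where kL: "k \<ge> 1" "direct_sum k L" "\<forall>i\<in>{1..k}. simple (L i)"
      using ss unfolding semisimple_def by blast
    have "k \<noteq> 1"
      using kL direct_sum_1_imp_UNIV[of L] ns by auto
    then show ?thesis
      using kL direct_sum_not_extreme[of k L] unfolding regular_extreme_def by auto
  qed
  then show ?thesis
    using direct_sum_not_extreme by blast
qed

end
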